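(* Let $A\in\mathbb{R}^{m\times n}$ and $b\in\mathbb{R}^m$ be such that $Ax=b$ is consistent, with $Ax^*=b$, and let $B\in\mathbb{R}^{n\times n}$ be symmetric positive definite. Let $S$ be a complete discrete sampling such that $S=S_i\in\mathbb{R}^{m\times q_i}$ with probability $$p_i=\frac{\mathrm{Tr}(S_i^TAB^{-1}A^TS_i)}{\|B^{-1/2}A^T\mathbf{S}\|_F^2},\qquad i=1,\ldots,r,$$ where $\mathbf{S}=[S_1,\ldots,S_r]$. Then the iterates $\{x^k\}_{k\ge0}$ of the randomized iterative method defined in the context, started from $x^0\in\mathbb{R}^n$, satisfy for every $k\ge0$ $$\mathbf{E}\left[\|x^k-x^*\|_B^2\right]\le\rho_c^k\,\|x^0-x^*\|_B^2,$$ where $$\rho_c=1-\frac{\lambda_{\min}\left(\mathbf{S}^TAB^{-1}A^T\mathbf{S}\right)}{\|B^{-1/2}A^T\mathbf{S}\|_F^2}.$$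
   Context: $M^\dagger$ is the Moore-Penrose pseudoinverse, $\lambda_{\min}$ the smallest eigenvalue, $\|\cdot\|_F$ the Frobenius norm, and $\|x\|_B=\sqrt{x^TBx}$ for $x\in\mathbb{R}^n$. The random matrix $S$ is called a complete discrete sampling (relative to $A$) if it has a discrete distribution of the following form: $S=S_i\in\mathbb{R}^{m\times q_i}$ with probability $p_i>0$, where $q_i\in\mathbb{N}$ and $S_i^TA$ has full row rank, for $i=1,\ldots,r$; and furthermore the concatenated matrix $\mathbf{S}=[S_1,\ldots,S_r]\in\mathbb{R}^{m\times\sum_{i=1}^rq_i}$ is such that $A^T\mathbf{S}$ has full row rank. Method: at each iteration $k\ge0$ an independent copy $S^{(k)}$ of $S$ is drawn (i.i.d. across iterations), and $$x^{k+1}=x^k-B^{-1}A^TS^{(k)}\left((S^{(k)})^TAB^{-1}A^TS^{(k)}\right)^{\dagger}(S^{(k)})^T(Ax^k-b).$$ *)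

theory Defs
  imports "HOL-Probability.Probability"
    "Jordan_Normal_Form.Matrix"
    "Jordan_Normal_Form.Gauss_Jordan_Elimination"
    "Jordan_Normal_Form.Char_Poly"
    "Jordan_Normal_Form.DL_Rank"
begin

definition spd_mat :: "nat \<Rightarrow> real mat \<Rightarrow> bool" where
  "spd_mat n B \<longleftrightarrow> B \<in> carrier_mat n n \<and> transpose_mat B = B
     \<and> (\<forall>x\<in>carrier_vec n. x \<noteq> 0\<^sub>v n \<longrightarrow> scalar_prod x (B *\<^sub>v x) > 0)"

text \<open>Only applied to invertible matrices, where \<open>mat_inverse\<close> is not \<open>None\<close>.\<close>

definition inv_mat :: "real mat \<Rightarrow> real mat" where
  "inv_mat B = the (mat_inverse B)"

text \<open>Only applied to symmetric positive definite matrices, where the positive definite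
  square root exists and is unique.\<close>

definition sqrt_mat :: "real mat \<Rightarrow> real mat" where
  "sqrt_mat X = (THE C. spd_mat (dim_row X) C \<and> C * C = X)"

definition inv_sqrt_mat :: "real mat \<Rightarrow> real mat" where
  "inv_sqrt_mat B = sqrt_mat (inv_mat B)"

definition trace_mat :: "real mat \<Rightarrow> real" where
  "trace_mat X = (\<Sum>i<dim_row X. X $$ (i, i))"

definition frob_norm :: "real mat \<Rightarrow> real" where
  "frob_norm X = sqrt (\<Sum>i<dim_row X. \<Sum>j<dim_col X. (X $$ (i, j))\<^sup>2)"

definition lambda_min :: "real mat \<Rightarrow> real" where
  "lambda_min X = Min {l. eigenvalue X l}"

definition norm_wrt :: "real mat \<Rightarrow> real vec \<Rightarrow> real" where
  "norm_wrt B x = sqrt (scalar_prod x (B *\<^sub>v x))"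

text \<open>The four Penrose conditions; they have exactly one solution.\<close>

definition is_pinv :: "real mat \<Rightarrow> real mat \<Rightarrow> bool" where
  "is_pinv M X \<longleftrightarrow> X \<in> carrier_mat (dim_col M) (dim_row M)
     \<and> M * X * M = M \<and> X * M * X = X
     \<and> transpose_mat (M * X) = M * X \<and> transpose_mat (X * M) = X * M"

definition pinv :: "real mat \<Rightarrow> real mat" where
  "pinv M = (THE X. is_pinv M X)"

text \<open>The first argument of \<open>vec_space.rank\<close> is the dimension of the column vectors.\<close>

definition full_row_rank :: "real mat \<Rightarrow> bool" where
  "full_row_rank X \<longleftrightarrow> vec_space.rank (dim_row X) X = dim_row X"

definition concat_mats :: "nat \<Rightarrow> nat \<Rightarrow> (nat \<Rightarrow> real mat) \<Rightarrow> real mat" where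
  "concat_mats m r S = mat_of_cols m (concat (map (\<lambda>i. cols (S i)) [1..<Suc r]))"

text \<open>\<open>D\<close> is the law of the random matrix. Its mass at \<open>X\<close> is the sum of the \<open>p i\<close> with
  \<open>S i = X\<close>, since the \<open>S i\<close> need not be distinct. The \<open>p i\<close> sum to 1 because \<open>D\<close> is a
  probability mass function.\<close>

definition complete_discrete_sampling ::
  "nat \<Rightarrow> real mat \<Rightarrow> nat \<Rightarrow> (nat \<Rightarrow> nat) \<Rightarrow> (nat \<Rightarrow> real mat) \<Rightarrow> (nat \<Rightarrow> real) \<Rightarrow> real mat pmf \<Rightarrow> bool"
where
  "complete_discrete_sampling m A r q S p D \<longleftrightarrow>
     (\<forall>X. pmf D X = (\<Sum>i | i \<in> {1..r} \<and> S i = X. p i))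
     \<and> (\<forall>i\<in>{1..r}. p i > 0 \<and> q i > 0 \<and> S i \<in> carrier_mat m (q i)
            \<and> full_row_rank (transpose_mat (S i) * A))
     \<and> full_row_rank (transpose_mat A * concat_mats m r S)"

text \<open>The argument \<open>S\<close> is one realisation of the sequence of sampled matrices.\<close>

primrec iterate ::
  "real mat \<Rightarrow> real mat \<Rightarrow> real vec \<Rightarrow> real vec \<Rightarrow> (nat \<Rightarrow> real mat) \<Rightarrow> nat \<Rightarrow> real vec"
where
  "iterate A B b x0 S 0 = x0"
| "iterate A B b x0 S (Suc k) =
     iterate A B b x0 S k
     - (inv_mat B * transpose_mat A * S k
          * pinv (transpose_mat (S k) * A * inv_mat B * transpose_mat A * S k)
          * transpose_mat (S k)) *\<^sub>v (A *\<^sub>v iterate A B b x0 S k - b)"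

end

theory Submission
  imports Defs
begin

text \<open>
  Write \<open>e\<close> for the error, \<open>F\<close> for the squared Frobenius norm and \<open>G\<^sub>i = S\<^sub>i\<^sup>T A B\<^sup>-\<^sup>1 A\<^sup>T S\<^sub>i\<close>.
  A step with sample \<open>S\<^sub>i\<close> is a \<open>B\<close>-orthogonal projection of \<open>e\<close>, and it lowers \<open>e\<^sup>T B e\<close> by
  \<open>w\<^sup>T G\<^sub>i w\<close> where \<open>G\<^sub>i w = S\<^sub>i\<^sup>T A e\<close>, hence by at least \<open>\<bar>S\<^sub>i\<^sup>T A e\<bar>\<^sup>2 / Tr G\<^sub>i\<close>. The weights
  \<open>p\<^sub>i = Tr G\<^sub>i / F\<close> cancel the traces, so the expected decrease is at least \<open>\<bar>\<^bold>S\<^sup>T A e\<bar>\<^sup>2 / F\<close>. This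
  is at least \<open>\<lambda>\<^sub>m\<^sub>i\<^sub>n / F\<close> times \<open>e\<^sup>T B e\<close>, because the minimum of the quotient of the two forms is an
  eigenvalue of \<open>\<^bold>S\<^sup>T A B\<^sup>-\<^sup>1 A\<^sup>T \<^bold>S\<close>. The number \<open>F\<close> enters only through \<open>p\<^sub>i\<close>, so no property of the
  square root of \<open>B\<^sup>-\<^sup>1\<close> is needed.
\<close>

unbundle no inner_syntax
unbundle no vec_syntax
hide_const (open) Determinants.det

subsection \<open>Positive semidefinite forms\<close>

text \<open>Symmetry belongs to the notion because a nonnegative quadratic form alone does not yield
  Cauchy-Schwarz; skew-symmetric matrices are counterexamples.\<close>

definition psd_mat:: "nat \<Rightarrow> real mat \<Rightarrow> bool" where
  "psd_mat n G \<longleftrightarrow> G \<in> carrier_mat n n \<and> transpose_mat G = G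
     \<and> (\<forall>x\<in>carrier_vec n. 0 \<le> x \<bullet> (G *\<^sub>v x))"

lemma spd_imp_psd: "spd_mat n B \<Longrightarrow> psd_mat n B"
proof -
  assume spd: "spd_mat n B"
  then have B: "B \<in> carrier_mat n n" by (simp add: spd_mat_def)
  have "0 \<le> x \<bullet> (B *\<^sub>v x)" if x: "x \<in> carrier_vec n" for x
  proof (cases "x = 0\<^sub>v n")
    case True
    have "B *\<^sub>v x \<in> carrier_vec n" using B x by simp
    then show ?thesis unfolding True by simp
  next
    case False
    with spd x have "0 < x \<bullet> (B *\<^sub>v x)" by (simp add: spd_mat_def)
    then show ?thesis by simp
  qed
  with spd show "psd_mat n B" by (simp add: spd_mat_def psd_mat_def)
qed

lemma psd_mat_one: "psd_mat n (1\<^sub>m n)"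
  unfolding psd_mat_def by (auto simp: scalar_prod_def intro: sum_nonneg)

lemma symmetric_mat_scalar_prod:
  fixes G :: "real mat"
  assumes "G \<in> carrier_mat n n" "transpose_mat G = G" "x \<in> carrier_vec n" "y \<in> carrier_vec n"
  shows "y \<bullet> (G *\<^sub>v x) = x \<bullet> (G *\<^sub>v y)"
  using transpose_vec_mult_scalar[of G n n x y] assms comm_scalar_prod[of "G *\<^sub>v y" n x]
  by auto

text \<open>Serves twice: as a polynomial in \<open>t\<close> for Cauchy-Schwarz, and at
  \<open>t = -1\<close> to measure the effect of one step of the method.\<close>

lemma quadratic_form_add_smult:
  fixes G :: "real mat"
  assumes G: "G \<in> carrier_mat n n" "transpose_mat G = G"
    and x: "x \<in> carrier_vec n" and y: "y \<in> carrier_vec n"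
  shows "(x + t \<cdot>\<^sub>v y) \<bullet> (G *\<^sub>v (x + t \<cdot>\<^sub>v y))
    = x \<bullet> (G *\<^sub>v x) + 2 * t * (x \<bullet> (G *\<^sub>v y)) + t\<^sup>2 * (y \<bullet> (G *\<^sub>v y))"
proof -
  have c: "G *\<^sub>v x \<in> carrier_vec n" "G *\<^sub>v y \<in> carrier_vec n" "t \<cdot>\<^sub>v y \<in> carrier_vec n"
    using G x y by auto
  have "G *\<^sub>v (x + t \<cdot>\<^sub>v y) = G *\<^sub>v x + t \<cdot>\<^sub>v (G *\<^sub>v y)"
    using G x y by (simp add: mult_add_distrib_mat_vec mult_mat_vec)
  then show ?thesis
    using c G x y symmetric_mat_scalar_prod[OF G x y]
    by (simp add: add_scalar_prod_distrib[of _ n] scalar_prod_add_distrib[of _ n]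
        power2_eq_square algebra_simps)
qed

text \<open>The form along the line \<open>x + t y\<close> is a quadratic in \<open>t\<close> that
  never becomes negative. Since \<open>G\<close> may be singular, the leading coefficient can vanish
  and is treated separately.\<close>

lemma psd_cauchy_schwarz:
  assumes "psd_mat n G" and x: "x \<in> carrier_vec n" and y: "y \<in> carrier_vec n"
  shows "(x \<bullet> (G *\<^sub>v y))\<^sup>2 \<le> (x \<bullet> (G *\<^sub>v x)) * (y \<bullet> (G *\<^sub>v y))"
proof -
  from assms have G: "G \<in> carrier_mat n n" "transpose_mat G = G"
    and pos: "\<And>x. x \<in> carrier_vec n \<Longrightarrow> 0 \<le> x \<bullet> (G *\<^sub>v x)"
    by (auto simp: psd_mat_def)
  define a b c where "a = x \<bullet> (G *\<^sub>v x)" and "b = x \<bullet> (G *\<^sub>v y)" and "c = y \<bullet> (G *\<^sub>v y)"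
  have q: "0 \<le> a + 2 * t * b + t\<^sup>2 * c" for t
    using pos[of "x + t \<cdot>\<^sub>v y"] x y unfolding a_def b_def c_def
    by (simp add: quadratic_form_add_smult[OF G x y])
  have "b\<^sup>2 \<le> a * c"
  proof (cases "c = 0")
    case True
    have "b = 0"
    proof (rule ccontr)
      assume b: "b \<noteq> 0"
      \<comment> \<open>With \<open>c = 0\<close> the quadratic is affine in \<open>t\<close>; this
        \<open>t\<close> is where it takes the value \<open>-1\<close>.\<close>
      have "0 \<le> a + 2 * (- (a + 1) / (2 * b)) * b" using q[of "- (a + 1) / (2 * b)"] True by simp
      also have "\<dots> = - 1" using b by (simp add: field_simps)
      finally show False by simp
    qed
    then show ?thesis using True by simp
  next
    case False
    with pos[OF y] have c: "c > 0" by (simp add: c_def)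
    \<comment> \<open>\<open>t = - b / c\<close> is the minimiser of the quadratic.\<close>
    have "0 \<le> a + 2 * (- b / c) * b + (- b / c)\<^sup>2 * c" by (rule q)
    also have "\<dots> = a - b\<^sup>2 / c" using c by (simp add: field_simps power2_eq_square)
    finally show ?thesis using c by (simp add: field_simps)
  qed
  then show ?thesis by (simp add: a_def b_def c_def)
qed

lemma scalar_prod_cauchy_schwarz:
  fixes x y :: "real vec"
  assumes "x \<in> carrier_vec n" "y \<in> carrier_vec n"
  shows "(x \<bullet> y)\<^sup>2 \<le> (x \<bullet> x) * (y \<bullet> y)"
  using psd_cauchy_schwarz[OF psd_mat_one assms] assms by simp

lemma scalar_prod_self_nonneg: "0 \<le> (x :: real vec) \<bullet> x"
  by (auto simp: scalar_prod_def intro: sum_nonneg)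

text \<open>Each coordinate of \<open>G u\<close> is bounded by Cauchy-Schwarz against a unit vector.\<close>

lemma psd_mult_vec_norm_le:
  assumes psd: "psd_mat n G" and u: "u \<in> carrier_vec n"
  shows "(G *\<^sub>v u) \<bullet> (G *\<^sub>v u) \<le> trace_mat G * (u \<bullet> (G *\<^sub>v u))"
proof -
  from psd have G: "G \<in> carrier_mat n n" by (simp add: psd_mat_def)
  have Gu: "G *\<^sub>v u \<in> carrier_vec n" using G u by simp
  have "((G *\<^sub>v u) $ i)\<^sup>2 \<le> G $$ (i, i) * (u \<bullet> (G *\<^sub>v u))" if i: "i < n" for i
  proof -
    have "unit_vec n i \<bullet> (G *\<^sub>v unit_vec n i) = G $$ (i, i)"
      using G i by simp
    then show ?thesis
      using psd_cauchy_schwarz[OF psd unit_vec_carrier u, of i] Gu i by simp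
  qed
  then have "(\<Sum>i<n. ((G *\<^sub>v u) $ i)\<^sup>2) \<le> (\<Sum>i<n. G $$ (i, i) * (u \<bullet> (G *\<^sub>v u)))"
    by (intro sum_mono) auto
  then show ?thesis using G Gu
    by (simp add: scalar_prod_def trace_mat_def sum_distrib_right power2_eq_square atLeast0LessThan)
qed

lemma psd_trace_nonneg: "psd_mat n G \<Longrightarrow> 0 \<le> trace_mat G"
proof -
  assume psd: "psd_mat n G"
  then have G: "G \<in> carrier_mat n n" by (simp add: psd_mat_def)
  have "0 \<le> G $$ (i, i)" if i: "i < n" for i
  proof -
    have "unit_vec n i \<bullet> (G *\<^sub>v unit_vec n i) = G $$ (i, i)"
      using G i by simp
    moreover have "0 \<le> unit_vec n i \<bullet> (G *\<^sub>v unit_vec n i)"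
      using psd unit_vec_carrier[of n i] unfolding psd_mat_def by blast
    ultimately show ?thesis by simp
  qed
  with G show ?thesis by (auto simp: trace_mat_def intro: sum_nonneg)
qed

text \<open>Cauchy-Schwarz for \<open>u\<close> and \<open>G u\<close>, combined with the bound on
  the norm of \<open>G u\<close>, gives the claim multiplied by the form at \<open>u\<close>; that
  factor is cancelled when it is nonzero.\<close>

lemma psd_quadratic_form_le:
  assumes psd: "psd_mat n G" and u: "u \<in> carrier_vec n"
  shows "u \<bullet> (G *\<^sub>v u) \<le> trace_mat G * (u \<bullet> u)"
proof -
  from psd have G: "G \<in> carrier_mat n n" by (simp add: psd_mat_def)
  have pos: "0 \<le> u \<bullet> (G *\<^sub>v u)" using psd u by (simp add: psd_mat_def)
  have "(u \<bullet> (G *\<^sub>v u))\<^sup>2 \<le> (u \<bullet> u) * ((G *\<^sub>v u) \<bullet> (G *\<^sub>v u))"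
    using scalar_prod_cauchy_schwarz[OF u, of "G *\<^sub>v u"] G u by simp
  also have "\<dots> \<le> (u \<bullet> u) * (trace_mat G * (u \<bullet> (G *\<^sub>v u)))"
    by (intro mult_left_mono psd_mult_vec_norm_le[OF psd u] scalar_prod_self_nonneg)
  finally have "(u \<bullet> (G *\<^sub>v u)) * (u \<bullet> (G *\<^sub>v u)) \<le> (trace_mat G * (u \<bullet> u)) * (u \<bullet> (G *\<^sub>v u))"
    by (simp add: power2_eq_square mult_ac)
  then show ?thesis
    using pos psd_trace_nonneg[OF psd] scalar_prod_self_nonneg[of u]
    by (cases "u \<bullet> (G *\<^sub>v u) = 0") auto
qed

section \<open>Inverses and congruences\<close>

lemma inv_mat_inverse:
  fixes G :: "real mat"
  assumes G: "G \<in> carrier_mat n n" and "det G \<noteq> 0"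
  shows "inv_mat G \<in> carrier_mat n n \<and> G * inv_mat G = 1\<^sub>m n \<and> inv_mat G * G = 1\<^sub>m n"
proof -
  \<comment> \<open>The argument \<open>()\<close> fixes the record extension of the matrix ring, so
    that both facts speak of units of the same ring.\<close>
  have "mat_inverse G \<noteq> None"
    using det_non_zero_imp_unit[OF assms, of "()"] mat_inverse(1)[OF G, of "()"] by blast
  then show ?thesis using mat_inverse(2)[OF G] by (auto simp: inv_mat_def)
qed

lemma spd_det_nonzero:
  assumes "spd_mat n B" shows "det B \<noteq> 0"
proof
  assume d: "det B = 0"
  from assms have B: "B \<in> carrier_mat n n" by (simp add: spd_mat_def)
  obtain v where v: "v \<in> carrier_vec n" "v \<noteq> 0\<^sub>v n" "B *\<^sub>v v = 0\<^sub>v n"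
    using d det_0_iff_vec_prod_zero_field[OF B] by auto
  with assms have "0 < v \<bullet> (B *\<^sub>v v)" unfolding spd_mat_def by blast
  then show False using v(1) unfolding v(3) by simp
qed

lemma symmetric_inv_mat:
  fixes G :: "real mat"
  assumes G: "G \<in> carrier_mat n n" "transpose_mat G = G" and "det G \<noteq> 0"
  shows "transpose_mat (inv_mat G) = inv_mat G"
proof -
  let ?I = "inv_mat G"
  have I: "?I \<in> carrier_mat n n" "G * ?I = 1\<^sub>m n" "?I * G = 1\<^sub>m n"
    using inv_mat_inverse assms by auto
  have "transpose_mat ?I = transpose_mat ?I * (G * ?I)" using I by simp
  also have "\<dots> = (transpose_mat ?I * transpose_mat G) * ?I"
    using I G by (simp add: assoc_mult_mat[of _ n n _ n _ n])
  also have "transpose_mat ?I * transpose_mat G = transpose_mat (G * ?I)"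
    using transpose_mult[OF G(1) I(1)] by simp
  also have "\<dots> * ?I = ?I" using I by simp
  finally show ?thesis .
qed

lemma quadratic_form_congruence:
  fixes G :: "real mat"
  assumes G: "G \<in> carrier_mat n n" and V: "V \<in> carrier_mat n k" and x: "x \<in> carrier_vec k"
  shows "x \<bullet> (transpose_mat V * G * V *\<^sub>v x) = (V *\<^sub>v x) \<bullet> (G *\<^sub>v (V *\<^sub>v x))"
proof -
  have "transpose_mat V * G * V *\<^sub>v x = transpose_mat V *\<^sub>v (G *\<^sub>v (V *\<^sub>v x))"
    using assoc_mult_mat_vec[of "transpose_mat V * G" k n V k x]
      assoc_mult_mat_vec[of "transpose_mat V" k n G n "V *\<^sub>v x"] G V x by simp
  then show ?thesis
    using transpose_vec_mult_scalar[of "transpose_mat V" k n "G *\<^sub>v (V *\<^sub>v x)" x] G V x by simp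
qed

lemma psd_congruence:
  assumes psd: "psd_mat n G" and V: "V \<in> carrier_mat n k"
  shows "psd_mat k (transpose_mat V * G * V)"
proof -
  from psd have G: "G \<in> carrier_mat n n" "transpose_mat G = G" by (auto simp: psd_mat_def)
  have "transpose_mat (transpose_mat V * G * V) = transpose_mat V * (transpose_mat G * V)"
    using transpose_mult[of "transpose_mat V * G" k n V k] transpose_mult[of "transpose_mat V" k n G n] G V
    by simp
  also have "\<dots> = transpose_mat V * G * V" using G V by (simp add: assoc_mult_mat[of _ k n _ n _ k])
  finally have "transpose_mat (transpose_mat V * G * V) = transpose_mat V * G * V" .
  moreover have "0 \<le> x \<bullet> (transpose_mat V * G * V *\<^sub>v x)" if x: "x \<in> carrier_vec k" for x
    unfolding quadratic_form_congruence[OF G(1) V x] using psd V x by (simp add: psd_mat_def)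
  ultimately show ?thesis using G V by (simp add: psd_mat_def)
qed

text \<open>The substitution \<open>x = B y\<close> turns the form of the inverse at
  \<open>x\<close> into the form of \<open>B\<close> at \<open>y\<close>.\<close>

lemma spd_inv_mat:
  assumes spd: "spd_mat n B" shows "spd_mat n (inv_mat B)"
proof -
  from spd have B: "B \<in> carrier_mat n n" "transpose_mat B = B" by (auto simp: spd_mat_def)
  note I = inv_mat_inverse[OF B(1) spd_det_nonzero[OF spd]]
  have "0 < x \<bullet> (inv_mat B *\<^sub>v x)" if x: "x \<in> carrier_vec n" "x \<noteq> 0\<^sub>v n" for x
  proof -
    let ?y = "inv_mat B *\<^sub>v x"
    have By: "B *\<^sub>v ?y = x" using I B x assoc_mult_mat_vec[of B n n "inv_mat B" n x] by simp
    have y: "?y \<in> carrier_vec n" using I x by auto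
    have "?y \<noteq> 0\<^sub>v n"
    proof
      assume "?y = 0\<^sub>v n"
      with By have "x = B *\<^sub>v 0\<^sub>v n" by simp
      also have "\<dots> = 0\<^sub>v n" using B by (intro eq_vecI) auto
      finally show False using x(2) by simp
    qed
    with y spd have "0 < ?y \<bullet> (B *\<^sub>v ?y)" unfolding spd_mat_def by blast
    then show ?thesis unfolding By using comm_scalar_prod[OF y x(1)] by simp
  qed
  with I symmetric_inv_mat[OF B spd_det_nonzero[OF spd]] show ?thesis by (simp add: spd_mat_def)
qed

lemma spd_congruence:
  assumes spd: "spd_mat n G" and V: "V \<in> carrier_mat n k"
    and inj: "\<And>x. x \<in> carrier_vec k \<Longrightarrow> V *\<^sub>v x = 0\<^sub>v n \<Longrightarrow> x = 0\<^sub>v k"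
  shows "spd_mat k (transpose_mat V * G * V)"
proof -
  from spd have G: "G \<in> carrier_mat n n" by (simp add: spd_mat_def)
  have "0 < x \<bullet> (transpose_mat V * G * V *\<^sub>v x)" if x: "x \<in> carrier_vec k" "x \<noteq> 0\<^sub>v k" for x
  proof -
    have "V *\<^sub>v x \<noteq> 0\<^sub>v n" using inj x by blast
    moreover have "V *\<^sub>v x \<in> carrier_vec n" using V x by simp
    ultimately have "0 < (V *\<^sub>v x) \<bullet> (G *\<^sub>v (V *\<^sub>v x))"
      using spd unfolding spd_mat_def by blast
    then show ?thesis unfolding quadratic_form_congruence[OF G V x(1)] .
  qed
  then show ?thesis
    using psd_congruence[OF spd_imp_psd[OF spd] V] by (simp add: spd_mat_def psd_mat_def)
qed

section \<open>Quotients of quadratic forms and the smallest eigenvalue\<close>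

text \<open>Let \<open>\<mu>\<close> be the infimum of the quotient of the two forms, so that
  \<open>M = C - \<mu> B\<close> is positive semidefinite. If \<open>M\<close> were invertible, its
  form would dominate \<open>1 / K\<close> times that of \<open>B\<close> for some
  \<open>K > 0\<close>, and the lower bound \<open>\<mu>\<close> could be raised by
  \<open>1 / K\<close>. Hence \<open>M\<close> is singular, and a kernel vector is the required
  \<open>y\<close>.\<close>

lemma generalized_eigenvalue_exists:
  assumes C: "psd_mat n C" and B: "spd_mat n B" and n: "n > 0"
  obtains \<mu> y where "y \<in> carrier_vec n" "y \<noteq> 0\<^sub>v n" "C *\<^sub>v y = \<mu> \<cdot>\<^sub>v (B *\<^sub>v y)"
    "\<And>x. x \<in> carrier_vec n \<Longrightarrow> \<mu> * (x \<bullet> (B *\<^sub>v x)) \<le> x \<bullet> (C *\<^sub>v x)"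
proof -
  from C have Cc: "C \<in> carrier_mat n n" "transpose_mat C = C"
    and C_pos: "\<And>x. x \<in> carrier_vec n \<Longrightarrow> 0 \<le> x \<bullet> (C *\<^sub>v x)"
    by (auto simp: psd_mat_def)
  from B have Bc: "B \<in> carrier_mat n n" "transpose_mat B = B"
    and B_pos: "\<And>x. x \<in> carrier_vec n \<Longrightarrow> x \<noteq> 0\<^sub>v n \<Longrightarrow> 0 < x \<bullet> (B *\<^sub>v x)"
    by (auto simp: spd_mat_def)
  define R where "R = (\<lambda>x. (x \<bullet> (C *\<^sub>v x)) / (x \<bullet> (B *\<^sub>v x))) ` {x \<in> carrier_vec n. x \<noteq> 0\<^sub>v n}"
  define \<mu> where "\<mu> = Inf R"
  define M where "M = C - \<mu> \<cdot>\<^sub>m B"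
  define e where "e = (unit_vec n 0 :: real vec)"
  have "e $ 0 = 1" using n by (simp add: e_def)
  then have e: "e \<in> carrier_vec n" "e \<noteq> 0\<^sub>v n" using n by (auto simp: e_def)
  have R_ne: "R \<noteq> {}" using e by (auto simp: R_def)
  have "bdd_below R"
    using C_pos B_pos by (intro bdd_belowI[of _ 0]) (auto simp: R_def intro!: divide_nonneg_pos)
  then have mu_le: "\<mu> \<le> (x \<bullet> (C *\<^sub>v x)) / (x \<bullet> (B *\<^sub>v x))" if "x \<in> carrier_vec n" "x \<noteq> 0\<^sub>v n" for x
    unfolding \<mu>_def using that by (intro cInf_lower) (auto simp: R_def)
  have mu_form: "\<mu> * (x \<bullet> (B *\<^sub>v x)) \<le> x \<bullet> (C *\<^sub>v x)" if x: "x \<in> carrier_vec n" for x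
  proof (cases "x = 0\<^sub>v n")
    case True
    have "B *\<^sub>v x \<in> carrier_vec n" "C *\<^sub>v x \<in> carrier_vec n" using Bc Cc x by auto
    then show ?thesis unfolding True by simp
  next
    case False
    then show ?thesis using mu_le[OF x] B_pos[OF x] by (simp add: field_simps)
  qed
  have "transpose_mat (\<mu> \<cdot>\<^sub>m B) = \<mu> \<cdot>\<^sub>m transpose_mat B" by (intro eq_matI) auto
  then have Mc: "M \<in> carrier_mat n n" "transpose_mat M = M"
    using Bc Cc by (auto simp: M_def transpose_minus)
  have Mx: "M *\<^sub>v x = C *\<^sub>v x - \<mu> \<cdot>\<^sub>v (B *\<^sub>v x)" if x: "x \<in> carrier_vec n" for x
  proof -
    have "(\<mu> \<cdot>\<^sub>m B) *\<^sub>v x = \<mu> \<cdot>\<^sub>v (B *\<^sub>v x)" using Bc x by (intro eq_vecI) auto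
    then show ?thesis
      using Bc Cc x by (simp add: M_def minus_mult_distrib_mat_vec[of _ n n])
  qed
  have M_form: "x \<bullet> (M *\<^sub>v x) = x \<bullet> (C *\<^sub>v x) - \<mu> * (x \<bullet> (B *\<^sub>v x))"
    if x: "x \<in> carrier_vec n" for x
    using Bc Cc x by (simp add: Mx[OF x] scalar_prod_minus_distrib[of _ n])
  have M: "psd_mat n M" using Mc mu_form by (auto simp: psd_mat_def M_form)
  have "det M = 0"
  proof (rule ccontr)
    assume d: "det M \<noteq> 0"
    note I = inv_mat_inverse[OF Mc(1) d]
    \<comment> \<open>The form of \<open>X\<close> at \<open>M y\<close> equals the form of
      \<open>B\<close> at \<open>y\<close>. Bounding it by the squared norm of \<open>M y\<close>,
      and that by the form of \<open>M\<close>, costs one trace each, whence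
      \<open>K\<close>.\<close>
    define X where "X = transpose_mat (inv_mat M) * B * inv_mat M"
    have X: "psd_mat n X" unfolding X_def
      using I psd_congruence[OF spd_imp_psd[OF B]] by blast
    define K where "K = trace_mat X * trace_mat M"
    have K: "y \<bullet> (B *\<^sub>v y) \<le> K * (y \<bullet> (M *\<^sub>v y))" if y: "y \<in> carrier_vec n" for y
    proof -
      let ?v = "M *\<^sub>v y"
      have v: "?v \<in> carrier_vec n" using Mc y by simp
      have "inv_mat M *\<^sub>v ?v = y"
        using assoc_mult_mat_vec[of "inv_mat M" n n M n y] I Mc y by simp
      then have "y \<bullet> (B *\<^sub>v y) = ?v \<bullet> (X *\<^sub>v ?v)"
        unfolding X_def using quadratic_form_congruence[OF Bc(1) _ v, of "inv_mat M"] I by simp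
      also have "\<dots> \<le> trace_mat X * (?v \<bullet> ?v)" by (rule psd_quadratic_form_le[OF X v])
      also have "\<dots> \<le> trace_mat X * (trace_mat M * (y \<bullet> (M *\<^sub>v y)))"
        by (intro mult_left_mono psd_mult_vec_norm_le[OF M y] psd_trace_nonneg[OF X])
      finally show ?thesis by (simp add: K_def)
    qed
    have "K \<noteq> 0" using K[OF e(1)] B_pos[OF e] by auto
    moreover have "K \<ge> 0" unfolding K_def
      by (intro mult_nonneg_nonneg psd_trace_nonneg[OF X] psd_trace_nonneg[OF M])
    ultimately have K0: "K > 0" by simp
    have "\<mu> + 1 / K \<le> \<mu>" unfolding \<mu>_def
    proof (rule cInf_greatest[OF R_ne])
      fix z assume "z \<in> R"
      then obtain x where x: "x \<in> carrier_vec n" "x \<noteq> 0\<^sub>v n"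
        and z: "z = (x \<bullet> (C *\<^sub>v x)) / (x \<bullet> (B *\<^sub>v x))" by (auto simp: R_def)
      have "x \<bullet> (B *\<^sub>v x) \<le> K * (x \<bullet> (C *\<^sub>v x) - \<mu> * (x \<bullet> (B *\<^sub>v x)))"
        using K[OF x(1)] by (simp add: M_form x)
      then show "Inf R + 1 / K \<le> z"
        using B_pos[OF x] K0 unfolding z \<mu>_def[symmetric] by (simp add: field_simps)
    qed
    with K0 show False by simp
  qed
  then obtain y where y: "y \<in> carrier_vec n" "y \<noteq> 0\<^sub>v n" "M *\<^sub>v y = 0\<^sub>v n"
    using det_0_iff_vec_prod_zero_field[OF Mc(1)] by auto
  have "C *\<^sub>v y = \<mu> \<cdot>\<^sub>v (B *\<^sub>v y)"
  proof (rule eq_vecI)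
    fix i assume "i < dim_vec (\<mu> \<cdot>\<^sub>v (B *\<^sub>v y))"
    then have i: "i < n" using Bc by simp
    then have "(M *\<^sub>v y) $ i = 0" using y(3) by simp
    then show "(C *\<^sub>v y) $ i = (\<mu> \<cdot>\<^sub>v (B *\<^sub>v y)) $ i"
      unfolding Mx[OF y(1)] using i Bc Cc by simp
  qed (use Bc Cc in auto)
  with y mu_form show thesis by (intro that[of y \<mu>])
qed

text \<open>\<open>Min\<close> is a lower bound only on finite sets, so the point is that the
  spectrum is finite: it consists of the roots of a monic polynomial.\<close>

lemma lambda_min_le_eigenvalue:
  assumes "N \<in> carrier_mat k k" "eigenvalue N l"
  shows "lambda_min N \<le> l"
proof -
  have "char_poly N \<noteq> 0" using degree_monic_char_poly[OF assms(1)] by auto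
  then have "finite {x. poly (char_poly N) x = 0}" by (rule poly_roots_finite)
  then have "finite {l. eigenvalue N l}"
    using eigenvalue_root_char_poly[OF assms(1)] by simp
  then show ?thesis unfolding lambda_min_def using assms(2) by (intro Min_le) auto
qed

text \<open>A minimiser \<open>y\<close> of the quotient of the two forms solves \<open>T T\<^sup>T y = \<mu> B y\<close>; then
  \<open>T\<^sup>T y\<close> is an eigenvector of \<open>T\<^sup>T B\<^sup>-\<^sup>1 T\<close> with the same \<open>\<mu>\<close>.\<close>

lemma lambda_min_quadratic_form_le:
  assumes B: "spd_mat n B" and T: "T \<in> carrier_mat n k"
    and inj: "\<And>x. x \<in> carrier_vec n \<Longrightarrow> transpose_mat T *\<^sub>v x = 0\<^sub>v k \<Longrightarrow> x = 0\<^sub>v n"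
    and e: "e \<in> carrier_vec n"
  shows "lambda_min (transpose_mat T * inv_mat B * T) * (e \<bullet> (B *\<^sub>v e))
    \<le> (transpose_mat T *\<^sub>v e) \<bullet> (transpose_mat T *\<^sub>v e)"
proof (cases "n = 0")
  \<comment> \<open>In dimension zero there is no nonzero vector to serve as an eigenvector, but the
    form of \<open>B\<close> is an empty sum.\<close>
  case True
  then show ?thesis
    using e scalar_prod_self_nonneg[of "transpose_mat T *\<^sub>v e"] B
    by (simp add: scalar_prod_def spd_mat_def)
next
  case False
  let ?N = "transpose_mat T * inv_mat B * T"
  from B have Bc: "B \<in> carrier_mat n n" by (simp add: spd_mat_def)
  note I = inv_mat_inverse[OF Bc spd_det_nonzero[OF B]]
  have Tt: "transpose_mat T \<in> carrier_mat k n" using T by simp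
  have C: "psd_mat n (T * transpose_mat T)"
    using psd_congruence[OF psd_mat_one Tt] T by simp
  obtain \<mu> y where y: "y \<in> carrier_vec n" "y \<noteq> 0\<^sub>v n"
      "(T * transpose_mat T) *\<^sub>v y = \<mu> \<cdot>\<^sub>v (B *\<^sub>v y)"
    and form: "\<And>x. x \<in> carrier_vec n \<Longrightarrow>
      \<mu> * (x \<bullet> (B *\<^sub>v x)) \<le> x \<bullet> ((T * transpose_mat T) *\<^sub>v x)"
    by (rule generalized_eigenvalue_exists[OF C B]) (use False in auto)
  let ?z = "transpose_mat T *\<^sub>v y"
  \<comment> \<open>An eigenvector has to be nonzero; this is where injectivity of the transpose of
    \<open>T\<close> enters.\<close>
  have z: "?z \<in> carrier_vec k" "?z \<noteq> 0\<^sub>v k" using Tt y inj by auto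
  have Tz: "T *\<^sub>v ?z = \<mu> \<cdot>\<^sub>v (B *\<^sub>v y)" using y(3) assoc_mult_mat_vec[OF T Tt y(1)] by simp
  have "inv_mat B *\<^sub>v (T *\<^sub>v ?z) = \<mu> \<cdot>\<^sub>v (inv_mat B *\<^sub>v (B *\<^sub>v y))"
    unfolding Tz using I Bc y(1) mult_mat_vec[of "inv_mat B" n n "B *\<^sub>v y" \<mu>] by simp
  also have "inv_mat B *\<^sub>v (B *\<^sub>v y) = y"
    using I Bc y assoc_mult_mat_vec[of "inv_mat B" n n B n y] by simp
  finally have BTz: "inv_mat B *\<^sub>v (T *\<^sub>v ?z) = \<mu> \<cdot>\<^sub>v y" .
  have "?N *\<^sub>v ?z = (transpose_mat T * inv_mat B) *\<^sub>v (T *\<^sub>v ?z)"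
    using I T Tt z(1) by (intro assoc_mult_mat_vec) auto
  also have "\<dots> = transpose_mat T *\<^sub>v (inv_mat B *\<^sub>v (T *\<^sub>v ?z))"
    using I T Tt z(1) by (intro assoc_mult_mat_vec) auto
  also have "\<dots> = \<mu> \<cdot>\<^sub>v ?z" unfolding BTz by (rule mult_mat_vec[OF Tt y(1)])
  finally have "?N *\<^sub>v ?z = \<mu> \<cdot>\<^sub>v ?z" .
  then have "eigenvalue ?N \<mu>"
    unfolding eigenvalue_def eigenvector_def using z T by (intro exI[of _ ?z]) auto
  then have "lambda_min ?N \<le> \<mu>" using I T by (intro lambda_min_le_eigenvalue[of _ k]) auto
  moreover have "0 \<le> e \<bullet> (B *\<^sub>v e)" using spd_imp_psd[OF B] e by (simp add: psd_mat_def)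
  ultimately have "lambda_min ?N * (e \<bullet> (B *\<^sub>v e)) \<le> \<mu> * (e \<bullet> (B *\<^sub>v e))"
    by (rule mult_right_mono)
  also have "\<dots> \<le> e \<bullet> ((T * transpose_mat T) *\<^sub>v e)" by (rule form[OF e])
  also have "\<dots> = (transpose_mat T *\<^sub>v e) \<bullet> (transpose_mat T *\<^sub>v e)"
    using assoc_mult_mat_vec[OF T Tt e] transpose_vec_mult_scalar[OF T _ e, of "transpose_mat T *\<^sub>v e"] Tt e
    by simp
  finally show ?thesis .
qed

section \<open>Full row rank and the pseudoinverse\<close>

text \<open>Rank \<open>q\<close> provides \<open>q\<close> independent columns of \<open>X\<close>,
  which form an invertible square matrix. A vector orthogonal to all columns of \<open>X\<close> is
  orthogonal to these, hence zero.\<close>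

lemma full_row_rank_transpose_inj:
  assumes rk: "full_row_rank X" and X: "X \<in> carrier_mat q n"
    and w: "w \<in> carrier_vec q" and Xw: "transpose_mat X *\<^sub>v w = 0\<^sub>v n"
  shows "w = 0\<^sub>v q"
proof -
  interpret V: vec_space "TYPE(real)" q .
  have rk': "V.rank X = q" using rk X by (simp add: full_row_rank_def)
  obtain U where U: "maximal U (\<lambda>T. T \<subseteq> set (cols X) \<and> V.lin_indpt T)" "finite U"
    using maximal_exists_superset[of "set (cols X)" "\<lambda>T. T \<subseteq> set (cols X) \<and> V.lin_indpt T" "{}"]
      V.finite_lin_indpt2[of "{}"] by auto
  have Us: "U \<subseteq> set (cols X)" "V.lin_indpt U" using U by (auto simp: maximal_def)
  have card: "card U = q" using V.rank_card_indpt[OF X U(1)] rk' by simp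
  obtain us where us: "set us = U" "distinct us" using finite_distinct_list[OF U(2)] by auto
  then have len: "length us = q" using card distinct_card by metis
  have us_c: "set us \<subseteq> carrier_vec q" using us Us X cols_dim[of X] by auto
  let ?Y = "mat_of_cols q us"
  have Y: "?Y \<in> carrier_mat q q" using len mat_of_cols_carrier(1)[of q us] by simp
  have "V.rank ?Y = q"
    using V.lin_indpt_full_rank[OF Y] us Us us_c by simp
  then have "det ?Y \<noteq> 0" using V.det_rank_iff[OF Y] by simp
  then have det: "det (transpose_mat ?Y) \<noteq> 0" using det_transpose[OF Y] by simp
  have "transpose_mat ?Y *\<^sub>v w = 0\<^sub>v q"
  proof (rule eq_vecI)
    fix i assume "i < dim_vec (0\<^sub>v q)"
    then have i: "i < length us" using len by simp
    then have "us ! i \<in> set (cols X)" using us Us by auto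
    then obtain j where j: "j < n" "us ! i = col X j"
      using X by (auto simp: cols_def)
    have "(transpose_mat X *\<^sub>v w) $ j = 0" using Xw j by simp
    then have "us ! i \<bullet> w = 0" using j X by simp
    then show "(transpose_mat ?Y *\<^sub>v w) $ i = 0\<^sub>v q $ i"
      using i len us_c Y col_mat_of_cols[of i us q] nth_mem[OF i] by (simp add: subset_iff)
  qed (use Y in auto)
  then show ?thesis
    using det det_0_iff_vec_prod_zero_field[of "transpose_mat ?Y" q] Y w by auto
qed

text \<open>Cancelling \<open>G\<close> on both sides of the Penrose condition
  \<open>G * X * G = G\<close> forces \<open>X\<close> to be the inverse; this is the uniqueness
  demanded by the description operator in \<open>pinv\<close>.\<close>

lemma pinv_eq_inv_mat:
  assumes G: "G \<in> carrier_mat n n" and d: "det G \<noteq> 0"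
  shows "pinv G = inv_mat G"
  unfolding pinv_def
proof (rule the_equality)
  note I = inv_mat_inverse[OF G d]
  show "is_pinv G (inv_mat G)" using I G by (auto simp: is_pinv_def)
  fix X assume "is_pinv G X"
  then have X: "X \<in> carrier_mat n n" and GXG: "G * X * G = G"
    using G by (auto simp: is_pinv_def)
  have "X = 1\<^sub>m n * X * 1\<^sub>m n" using X by simp
  also have "\<dots> = inv_mat G * G * X * (G * inv_mat G)" using I by metis
  also have "\<dots> = inv_mat G * (G * X * G) * inv_mat G"
    using X G conjunct1[OF I] by (simp add: assoc_mult_mat[of _ n n _ n _ n])
  also have "\<dots> = inv_mat G" using I G by (auto simp: GXG)
  finally show "X = inv_mat G" .
qed

subsection \<open>One step of the method\<close>

text \<open>The factors are bracketed as in \<open>iterate\<close>, so that unfolding identifies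
  this matrix with the one in the recursion.\<close>

definition correction_mat :: "real mat \<Rightarrow> real mat \<Rightarrow> real mat \<Rightarrow> real mat" where
  "correction_mat A B X = inv_mat B * transpose_mat A * X
     * pinv (transpose_mat X * A * inv_mat B * transpose_mat A * X) * transpose_mat X"

text \<open>Consistency turns the residual into \<open>A\<close> applied to the error, so the error
  obeys a homogeneous linear recursion.\<close>

lemma iterate_Suc_error:
  assumes A: "A \<in> carrier_mat m n" and xs: "xstar \<in> carrier_vec n" and b: "A *\<^sub>v xstar = b"
    and x: "iterate A B b x0 S k \<in> carrier_vec n" and Bi: "inv_mat B \<in> carrier_mat n n"
  shows "iterate A B b x0 S (Suc k) - xstar
    = (iterate A B b x0 S k - xstar)
      - correction_mat A B (S k) *\<^sub>v (A *\<^sub>v (iterate A B b x0 S k - xstar))"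
proof -
  have "A *\<^sub>v iterate A B b x0 S k - b = A *\<^sub>v (iterate A B b x0 S k - xstar)"
    using mult_minus_distrib_mat_vec[OF A x xs] b by simp
  then have "iterate A B b x0 S (Suc k)
      = iterate A B b x0 S k - correction_mat A B (S k) *\<^sub>v (A *\<^sub>v (iterate A B b x0 S k - xstar))"
    by (simp add: correction_mat_def)
  moreover have "dim_row (correction_mat A B (S k)) = n" using Bi by (simp add: correction_mat_def)
  ultimately show ?thesis using x xs by (intro eq_vecI) auto
qed

lemma spd_norm_wrt_sq:
  "spd_mat n B \<Longrightarrow> x \<in> carrier_vec n \<Longrightarrow> (norm_wrt B x)\<^sup>2 = x \<bullet> (B *\<^sub>v x)"
  using spd_imp_psd[of n B] by (simp add: norm_wrt_def psd_mat_def)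

text \<open>With \<open>V = S\<^sup>T A\<close>, \<open>u = V e\<close> and \<open>G w = u\<close>, the squared norm drops by exactly \<open>w \<bullet> u\<close>.\<close>

lemma correction_step:
  assumes A: "A \<in> carrier_mat m n" and S: "S \<in> carrier_mat m q" and B: "spd_mat n B"
    and rk: "full_row_rank (transpose_mat S * A)" and e: "e \<in> carrier_vec n"
  defines "e' \<equiv> e - correction_mat A B S *\<^sub>v (A *\<^sub>v e)"
    and "G \<equiv> transpose_mat S * A * inv_mat B * transpose_mat A * S"
  shows "psd_mat q G"
    and "(norm_wrt B e')\<^sup>2 \<le> (norm_wrt B e)\<^sup>2"
    and "(transpose_mat S *\<^sub>v (A *\<^sub>v e)) \<bullet> (transpose_mat S *\<^sub>v (A *\<^sub>v e))
      \<le> trace_mat G * ((norm_wrt B e)\<^sup>2 - (norm_wrt B e')\<^sup>2)"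
proof -
  from B have Bc: "B \<in> carrier_mat n n" "transpose_mat B = B" by (auto simp: spd_mat_def)
  define I where "I = inv_mat B"
  have I: "I \<in> carrier_mat n n" "B * I = 1\<^sub>m n"
    using inv_mat_inverse[OF Bc(1) spd_det_nonzero[OF B]] by (auto simp: I_def)
  define V where "V = transpose_mat S * A"
  have V: "V \<in> carrier_mat q n" using A S by (auto simp: V_def)
  have Vt: "transpose_mat V = transpose_mat A * S" "transpose_mat V \<in> carrier_mat n q"
    using A S transpose_mult[of "transpose_mat S" q m A n] by (auto simp: V_def)
  have G_eq: "G = V * I * transpose_mat V"
    unfolding G_def Vt(1) I_def[symmetric] V_def[symmetric]
    using V I A S by (intro assoc_mult_mat[of _ q n _ m _ q]) auto
  \<comment> \<open>Full row rank makes the transpose of \<open>V\<close> injective, so the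
    congruence keeps definiteness and the pseudoinverse of \<open>G\<close> is a true
    inverse.\<close>
  have spdG: "spd_mat q G"
  proof -
    have "spd_mat q (transpose_mat (transpose_mat V) * I * transpose_mat V)"
      unfolding I_def using Vt(2) full_row_rank_transpose_inj[of V q n] rk V
      by (intro spd_congruence[OF spd_inv_mat[OF B]]) (auto simp: V_def)
    then show ?thesis by (simp add: G_eq)
  qed
  then have Gc: "G \<in> carrier_mat q q" by (simp add: spd_mat_def)
  show psdG: "psd_mat q G" using spd_imp_psd[OF spdG] .
  note dG = spd_det_nonzero[OF spdG]
  define P where "P = pinv G"
  have P: "P \<in> carrier_mat q q" "G * P = 1\<^sub>m q"
    using inv_mat_inverse[OF Gc dG] pinv_eq_inv_mat[OF Gc dG] by (auto simp: P_def)
  define u where "u = V *\<^sub>v e"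
  define w where "w = P *\<^sub>v u"
  define d where "d = I *\<^sub>v (transpose_mat V *\<^sub>v w)"
  have u: "u \<in> carrier_vec q" using V e by (simp add: u_def)
  have w: "w \<in> carrier_vec q" using P u by (simp add: w_def)
  have Vw: "transpose_mat V *\<^sub>v w \<in> carrier_vec n" using Vt w by simp
  have d: "d \<in> carrier_vec n" using I Vw by (simp add: d_def)
  have Gw: "G *\<^sub>v w = u"
    using assoc_mult_mat_vec[OF Gc P(1) u] P u by (simp add: w_def)
  have u_eq: "u = transpose_mat S *\<^sub>v (A *\<^sub>v e)"
    using assoc_mult_mat_vec[of "transpose_mat S" q m A n e] A S e by (simp add: u_def V_def)
  have "correction_mat A B S = I * transpose_mat V * P * transpose_mat S"
    unfolding correction_mat_def G_def[symmetric] P_def[symmetric]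
    unfolding I_def[symmetric] Vt(1)
    using assoc_mult_mat[of I n n "transpose_mat A" m S q] I A S by simp
  then have "correction_mat A B S *\<^sub>v (A *\<^sub>v e)
      = (I * transpose_mat V * P * transpose_mat S) *\<^sub>v (A *\<^sub>v e)" by simp
  also have "\<dots> = (I * transpose_mat V * P) *\<^sub>v u"
    unfolding u_eq using mult_carrier_mat[OF mult_carrier_mat[OF I(1) Vt(2)] P(1)]
    by (rule assoc_mult_mat_vec) (use A S e in auto)
  also have "\<dots> = (I * transpose_mat V) *\<^sub>v w"
    unfolding w_def using mult_carrier_mat[OF I(1) Vt(2)] P(1) u by (rule assoc_mult_mat_vec)
  also have "\<dots> = d"
    unfolding d_def using I(1) Vt(2) w by (rule assoc_mult_mat_vec)
  finally have e'_eq: "e' = e + (-1) \<cdot>\<^sub>v d"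
    unfolding e'_def using e d by (intro eq_vecI) auto
  then have e': "e' \<in> carrier_vec n" using e d by simp
  have Bd: "B *\<^sub>v d = transpose_mat V *\<^sub>v w"
    using assoc_mult_mat_vec[OF Bc(1) I(1) Vw] I Vw by (simp add: d_def)
  \<comment> \<open>The mixed term here and the form at \<open>d\<close> below have the same value;
    in the expansion at \<open>t = -1\<close> they enter with factors \<open>-2\<close> and
    \<open>1\<close>, which leaves a drop of exactly \<open>w \<bullet> u\<close>.\<close>
  have eBd: "e \<bullet> (B *\<^sub>v d) = w \<bullet> u"
    unfolding Bd u_def using transpose_vec_mult_scalar[OF V e w] comm_scalar_prod[OF Vw e] by simp
  have "V *\<^sub>v d = G *\<^sub>v w"
  proof -
    have "G *\<^sub>v w = (V * I) *\<^sub>v (transpose_mat V *\<^sub>v w)"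
      unfolding G_eq using mult_carrier_mat[OF V I(1)] Vt(2) w by (rule assoc_mult_mat_vec)
    also have "\<dots> = V *\<^sub>v d"
      unfolding d_def using V I(1) Vw by (rule assoc_mult_mat_vec)
    finally show ?thesis ..
  qed
  then have dBd: "d \<bullet> (B *\<^sub>v d) = w \<bullet> u"
    unfolding Bd using transpose_vec_mult_scalar[OF V d w] comm_scalar_prod[OF Vw d] Gw by simp
  have drop: "(norm_wrt B e)\<^sup>2 - (norm_wrt B e')\<^sup>2 = w \<bullet> u"
    unfolding spd_norm_wrt_sq[OF B e] spd_norm_wrt_sq[OF B e'] unfolding e'_eq
    by (simp add: quadratic_form_add_smult[OF Bc e d] eBd dBd)
  have "0 \<le> w \<bullet> (G *\<^sub>v w)" using psdG w by (simp add: psd_mat_def)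
  then show "(norm_wrt B e')\<^sup>2 \<le> (norm_wrt B e)\<^sup>2" using drop by (simp add: Gw)
  have "(G *\<^sub>v w) \<bullet> (G *\<^sub>v w) \<le> trace_mat G * (w \<bullet> (G *\<^sub>v w))"
    by (rule psd_mult_vec_norm_le[OF psdG w])
  then show "(transpose_mat S *\<^sub>v (A *\<^sub>v e)) \<bullet> (transpose_mat S *\<^sub>v (A *\<^sub>v e))
      \<le> trace_mat G * ((norm_wrt B e)\<^sup>2 - (norm_wrt B e')\<^sup>2)"
    by (simp add: drop Gw flip: u_eq)
qed

section \<open>Averaging over the sampling distribution\<close>

text \<open>Summing over the list of columns fits \<open>concat_mats\<close>, whose column list is a
  concatenation: the squared norm then splits into blocks.\<close>

lemma scalar_prod_transpose_mult_self:
  fixes X :: "real mat"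
  assumes "v \<in> carrier_vec (dim_row X)"
  shows "(transpose_mat X *\<^sub>v v) \<bullet> (transpose_mat X *\<^sub>v v) = (\<Sum>c\<leftarrow>cols X. (c \<bullet> v)\<^sup>2)"
  by (simp add: scalar_prod_def[of "transpose_mat X *\<^sub>v v"] cols_def power2_eq_square comp_def
      interv_sum_list_conv_sum_set_nat)

lemma concat_mats_carrier: "concat_mats m r S \<in> carrier_mat m (dim_col (concat_mats m r S))"
  by (auto simp: concat_mats_def)

lemma scalar_prod_transpose_concat_mats:
  assumes S: "\<And>i. i \<in> {1..r} \<Longrightarrow> S i \<in> carrier_mat m (q i)" and v: "v \<in> carrier_vec m"
  shows "(transpose_mat (concat_mats m r S) *\<^sub>v v) \<bullet> (transpose_mat (concat_mats m r S) *\<^sub>v v)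
    = (\<Sum>i\<in>{1..r}. (transpose_mat (S i) *\<^sub>v v) \<bullet> (transpose_mat (S i) *\<^sub>v v))"
proof -
  let ?cs = "concat (map (\<lambda>i. cols (S i)) [1..<Suc r])"
  have "set (cols (S i)) \<subseteq> carrier_vec m" if "i \<in> {1..r}" for i
    using cols_dim[of "S i"] S[OF that] by auto
  then have cs: "set ?cs \<subseteq> carrier_vec m" by fastforce
  have "dim_row (concat_mats m r S) = m" by (simp add: concat_mats_def)
  then have "(transpose_mat (concat_mats m r S) *\<^sub>v v) \<bullet> (transpose_mat (concat_mats m r S) *\<^sub>v v)
      = (\<Sum>c\<leftarrow>?cs. (c \<bullet> v)\<^sup>2)"
    using v cols_mat_of_cols[OF cs] by (subst scalar_prod_transpose_mult_self) (auto simp: concat_mats_def)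
  also have "\<dots> = (\<Sum>i\<leftarrow>[1..<Suc r]. \<Sum>c\<leftarrow>cols (S i). (c \<bullet> v)\<^sup>2)"
    by (induction r) (simp_all add: map_concat)
  also have "\<dots> = (\<Sum>i\<in>{1..r}. \<Sum>c\<leftarrow>cols (S i). (c \<bullet> v)\<^sup>2)"
    by (simp add: interv_sum_list_conv_sum_set_nat atLeastLessThanSuc_atLeastAtMost del: upt_Suc)
  also have "\<dots> = (\<Sum>i\<in>{1..r}. (transpose_mat (S i) *\<^sub>v v) \<bullet> (transpose_mat (S i) *\<^sub>v v))"
    using v S by (intro sum.cong refl scalar_prod_transpose_mult_self[symmetric]) auto
  finally show ?thesis .
qed

lemma sampling_set_pmf:
  assumes "complete_discrete_sampling m A r q S p D"
  shows "set_pmf D \<subseteq> S ` {1..r}"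
proof
  fix X assume "X \<in> set_pmf D"
  then have "(\<Sum>i | i \<in> {1..r} \<and> S i = X. p i) \<noteq> 0"
    using assms by (auto simp: complete_discrete_sampling_def set_pmf_iff)
  then have "{i. i \<in> {1..r} \<and> S i = X} \<noteq> {}" by (metis sum.empty)
  then show "X \<in> S ` {1..r}" by blast
qed

text \<open>Different indices may carry the same matrix; the mass of \<open>D\<close> at
  \<open>X\<close> collects all of them, so both sides are one sum grouped differently.\<close>

lemma sampling_sum_pmf:
  assumes "complete_discrete_sampling m A r q S p D"
  shows "(\<Sum>X\<in>S ` {1..r}. pmf D X * g X) = (\<Sum>i\<in>{1..r}. p i * (g (S i) :: real))"
proof -
  have "(\<Sum>X\<in>S ` {1..r}. pmf D X * g X)
      = (\<Sum>X\<in>S ` {1..r}. \<Sum>i | i \<in> {1..r} \<and> S i = X. p i * g (S i))"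
    using assms by (intro sum.cong refl) (auto simp: complete_discrete_sampling_def sum_distrib_right)
  also have "\<dots> = (\<Sum>i\<in>{1..r}. p i * g (S i))"
    by (rule sum.image_gen[symmetric]) simp
  finally show ?thesis .
qed

text \<open>The error \<open>e\<close> is fixed, so this is the one-step bound conditional on the
  past, with the expectation written as a finite sum over the possible samples.\<close>

lemma expected_correction_step:
  assumes A: "A \<in> carrier_mat m n" and B: "spd_mat n B"
    and D: "complete_discrete_sampling m A r q S p D" and e: "e \<in> carrier_vec n"
    and p: "\<And>i. i \<in> {1..r} \<Longrightarrow>
      p i = trace_mat (transpose_mat (S i) * A * inv_mat B * transpose_mat A * S i) / F" and F: "F \<ge> 0"
  shows "(\<Sum>X\<in>S ` {1..r}. pmf D X * (norm_wrt B (e - correction_mat A B X *\<^sub>v (A *\<^sub>v e)))\<^sup>2)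
    \<le> (1 - lambda_min (transpose_mat (concat_mats m r S) * A * inv_mat B
             * transpose_mat A * concat_mats m r S) / F) * (norm_wrt B e)\<^sup>2"
proof -
  let ?C = "concat_mats m r S" and ?N = "(norm_wrt B e)\<^sup>2"
  let ?N' = "\<lambda>i. (norm_wrt B (e - correction_mat A B (S i) *\<^sub>v (A *\<^sub>v e)))\<^sup>2"
  let ?G = "\<lambda>i. transpose_mat (S i) * A * inv_mat B * transpose_mat A * S i"
  let ?u = "\<lambda>i. transpose_mat (S i) *\<^sub>v (A *\<^sub>v e)"
  from D have p_pos: "p i > 0" and S: "S i \<in> carrier_mat m (q i)"
    and rk: "full_row_rank (transpose_mat (S i) * A)" if "i \<in> {1..r}" for i
    using that by (auto simp: complete_discrete_sampling_def)
  from D have rkC: "full_row_rank (transpose_mat A * ?C)" by (simp add: complete_discrete_sampling_def)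
  note step = correction_step[OF A S B rk e]
  have sum_p: "(\<Sum>i\<in>{1..r}. p i) = 1"
    using sampling_sum_pmf[OF D, of "\<lambda>_. 1"] sum_pmf_eq_1[OF _ sampling_set_pmf[OF D]] by simp
  then have "{1..r} \<noteq> {}" by (metis sum.empty zero_neq_one)
  then obtain i where "i \<in> {1..r}" by blast
  \<comment> \<open>Division by zero yields zero, so a positive probability excludes
    \<open>F = 0\<close>.\<close>
  then have "trace_mat (?G i) / F > 0" using p_pos p by metis
  with F have F0: "F > 0" by (cases "F = 0") auto
  define Q where "Q = dim_col ?C"
  have C: "?C \<in> carrier_mat m Q" unfolding Q_def by (rule concat_mats_carrier)
  let ?T = "transpose_mat A * ?C"
  have T: "?T \<in> carrier_mat n Q" using A C by simp
  have Tt: "transpose_mat ?T = transpose_mat ?C * A"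
    using transpose_mult[of "transpose_mat A" n m ?C Q] A C by simp
  have Bi: "inv_mat B \<in> carrier_mat n n"
    using spd_inv_mat[OF B] by (simp add: spd_mat_def)
  have "transpose_mat ?T * inv_mat B * ?T
      = transpose_mat ?C * A * inv_mat B * transpose_mat A * ?C" (is "_ = ?M")
    unfolding Tt using A C Bi by (intro assoc_mult_mat[of _ Q n _ m _ Q, symmetric]) auto
  moreover have "transpose_mat ?T *\<^sub>v e = transpose_mat ?C *\<^sub>v (A *\<^sub>v e)"
    unfolding Tt using A C e by (intro assoc_mult_mat_vec) auto
  ultimately have "lambda_min ?M * ?N
      \<le> (transpose_mat ?C *\<^sub>v (A *\<^sub>v e)) \<bullet> (transpose_mat ?C *\<^sub>v (A *\<^sub>v e))"
    using lambda_min_quadratic_form_le[OF B T _ e] full_row_rank_transpose_inj[OF rkC T]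
    by (simp add: spd_norm_wrt_sq[OF B e])
  also have "\<dots> = (\<Sum>i\<in>{1..r}. ?u i \<bullet> ?u i)"
    using A e S by (intro scalar_prod_transpose_concat_mats[of r S m q]) auto
  also have "\<dots> \<le> (\<Sum>i\<in>{1..r}. trace_mat (?G i) * (?N - ?N' i))"
    by (intro sum_mono step(3)) auto
  also have "\<dots> = (\<Sum>i\<in>{1..r}. F * (p i * (?N - ?N' i)))"
    using p F0 by (intro sum.cong) auto
  also have "\<dots> = F * (?N - (\<Sum>i\<in>{1..r}. p i * ?N' i))"
    using sum_p by (simp add: right_diff_distrib sum_subtractf flip: sum_distrib_left sum_distrib_right)
  finally have "lambda_min ?M / F * ?N \<le> ?N - (\<Sum>i\<in>{1..r}. p i * ?N' i)"
    using F0 by (simp add: field_simps)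
  then show ?thesis unfolding sampling_sum_pmf[OF D] by (simp add: left_diff_distrib)
qed

subsection \<open>Measurability and independence\<close>

lemma borel_measurable_mat_vec_index:
  fixes A :: "real mat"
  assumes "\<And>l. l < d \<Longrightarrow> (\<lambda>h. v h $ l) \<in> borel_measurable N"
    and "\<And>h. v h \<in> carrier_vec d" and "i < dim_row A" "dim_col A = d"
  shows "(\<lambda>h. (A *\<^sub>v v h) $ i) \<in> borel_measurable N"
proof -
  have "dim_vec (v h) = d" for h using assms(2) by auto
  then have "(\<lambda>h. (A *\<^sub>v v h) $ i) = (\<lambda>h. \<Sum>l\<in>{0..<d}. A $$ (i, l) * v h $ l)"
    using assms(3,4) by (auto simp: scalar_prod_def)
  then show ?thesis using assms(1) by simp
qed

lemma borel_measurable_norm_wrt_sq: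
  assumes v: "\<And>l. l < d \<Longrightarrow> (\<lambda>h. v h $ l) \<in> borel_measurable N"
    and vc: "\<And>h. v h \<in> carrier_vec d" and B: "B \<in> carrier_mat d d"
  shows "(\<lambda>h. (norm_wrt B (v h))\<^sup>2) \<in> borel_measurable N"
proof -
  have "v h \<bullet> (B *\<^sub>v v h) = (\<Sum>i\<in>{0..<d}. v h $ i * (B *\<^sub>v v h) $ i)" for h
    using B by (simp add: scalar_prod_def)
  moreover have "(\<lambda>h. \<Sum>i\<in>{0..<d}. v h $ i * (B *\<^sub>v v h) $ i) \<in> borel_measurable N"
    using B by (intro borel_measurable_sum borel_measurable_times v borel_measurable_mat_vec_index[OF v vc]) auto
  ultimately have "(\<lambda>h. v h \<bullet> (B *\<^sub>v v h)) \<in> borel_measurable N" by simp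
  then show ?thesis unfolding norm_wrt_def by measurable
qed

lemma iterate_carrier:
  assumes "x0 \<in> carrier_vec n" "inv_mat B \<in> carrier_mat n n"
  shows "iterate A B b x0 s k \<in> carrier_vec n"
proof (induction k)
  case (Suc k)
  \<comment> \<open>The dimension of a vector difference is that of the subtrahend, here the number
    of rows of \<open>inv_mat B\<close>; hence sample matrices of any shape are covered.\<close>
  show ?case using assms(2) by (intro carrier_vecI) simp
qed (use assms in simp)

text \<open>Lets the full sample sequence be replaced by the history of the first \<open>k\<close>
  draws, which is independent of the next draw.\<close>

lemma iterate_cong:
  "(\<And>j. j < k \<Longrightarrow> s j = t j) \<Longrightarrow> iterate A B b x0 s k = iterate A B b x0 t k"
proof (induction k)
  case (Suc k)
  then have "iterate A B b x0 s k = iterate A B b x0 t k" "s k = t k" by auto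
  then show ?case by (simp only: iterate.simps)
qed simp

text \<open>The correction applied to \<open>A x - b\<close> has entries depending on a single sample only, so they are
  measurable without any regularity of \<open>pinv\<close>. This matters because the iterates must be measurable
  also on the null set where a sample leaves the support, and because a function of several samples need
  not be measurable for a product of discrete sigma-algebras.\<close>

lemma borel_measurable_iterate_index:
  assumes x0: "x0 \<in> carrier_vec n" and Bi: "inv_mat B \<in> carrier_mat n n"
    and A: "A \<in> carrier_mat m n" and b: "b \<in> carrier_vec m"
  shows "k \<le> K \<Longrightarrow> i < n \<Longrightarrow>
    (\<lambda>h. iterate A B b x0 h k $ i) \<in> borel_measurable (\<Pi>\<^sub>M j\<in>{..<K}. count_space UNIV)"
proof (induction k arbitrary: i)
  case 0
  then show ?case by simp
next
  case (Suc k)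
  let ?N = "\<Pi>\<^sub>M j\<in>{..<K}. count_space (UNIV :: real mat set)"
  let ?K = "correction_mat A B" and ?x = "\<lambda>h. iterate A B b x0 h k"
  let ?r = "\<lambda>h. A *\<^sub>v ?x h - b"
  have dim: "dim_row (?K X) = n" for X using Bi by (simp add: correction_mat_def)
  have r: "?r h \<in> carrier_vec m" for h using b by (intro carrier_vecI) simp
  have x_meas: "(\<lambda>h. ?x h $ l) \<in> borel_measurable ?N" if "l < n" for l
    using Suc.IH Suc.prems(1) that by simp
  have r_meas: "(\<lambda>h. ?r h $ l) \<in> borel_measurable ?N" if l: "l < m" for l
  proof -
    have "?r h $ l = (A *\<^sub>v ?x h) $ l - b $ l" for h using l A b by simp
    moreover have "(\<lambda>h. (A *\<^sub>v ?x h) $ l) \<in> borel_measurable ?N"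
    proof (rule borel_measurable_mat_vec_index[OF x_meas])
      show "?x h \<in> carrier_vec n" for h by (rule iterate_carrier[OF x0 Bi])
    qed (use A l in auto)
    ultimately show ?thesis by simp
  qed
  have coeff: "(\<lambda>h. row (?K (h k)) i $ l) \<in> borel_measurable ?N" for l
  proof -
    have "(\<lambda>h. h k) \<in> measurable ?N (count_space UNIV)"
      using Suc.prems by (intro measurable_component_singleton) auto
    moreover have "(\<lambda>X. row (?K X) i $ l) \<in> borel_measurable (count_space UNIV)" by simp
    ultimately show ?thesis by (rule measurable_compose)
  qed
  \<comment> \<open>\<open>scalar_prod\<close> takes its index range from its second argument, here
    the residual of dimension \<open>m\<close>, so the formula holds for samples of any
    shape.\<close>
  have "iterate A B b x0 h (Suc k) $ i
      = ?x h $ i - (\<Sum>l\<in>{0..<m}. row (?K (h k)) i $ l * ?r h $ l)" for h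
  proof -
    have "iterate A B b x0 h (Suc k) = ?x h - ?K (h k) *\<^sub>v ?r h" by (simp add: correction_mat_def)
    moreover have "(?K (h k) *\<^sub>v ?r h) $ i = (\<Sum>l\<in>{0..<m}. row (?K (h k)) i $ l * ?r h $ l)"
      using Suc.prems(2) dim[of "h k"]
      by (simp only: index_mult_mat_vec scalar_prod_def carrier_vecD[OF r])
    ultimately show ?thesis using Suc.prems dim[of "h k"] by simp
  qed
  moreover have "(\<lambda>h. ?x h $ i - (\<Sum>l\<in>{0..<m}. row (?K (h k)) i $ l * ?r h $ l))
      \<in> borel_measurable ?N"
  proof (intro borel_measurable_diff borel_measurable_sum borel_measurable_times)
    show "(\<lambda>h. ?x h $ i) \<in> borel_measurable ?N" using x_meas Suc.prems(2) .
    show "(\<lambda>h. row (?K (h k)) i $ l) \<in> borel_measurable ?N" for l by (rule coeff)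
    show "(\<lambda>h. ?r h $ l) \<in> borel_measurable ?N" if "l \<in> {0..<m}" for l using that r_meas by simp
  qed
  ultimately show ?case by (simp only:)
qed

section \<open>Expectations under independence and geometric decay\<close>

text \<open>Almost surely \<open>Z\<close> lies in \<open>F\<close>, and there
  \<open>g (Z \<omega>) \<omega>\<close> is the sum of \<open>g z\<close> times the indicator of
  \<open>Z = z\<close>. Independence factors the expectation of each summand.\<close>

lemma (in prob_space) expectation_indep_finite_pmf:
  fixes g :: "'z \<Rightarrow> 'a \<Rightarrow> real"
  assumes ind: "\<And>z. z \<in> F \<Longrightarrow> indep_var borel (g z) borel (\<lambda>\<omega>. indicator {z} (Z \<omega>))"
    and Zm: "Z \<in> measurable M (count_space UNIV)"
    and Z: "distr M (count_space UNIV) Z = measure_pmf D"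
    and F: "finite F" "set_pmf D \<subseteq> F"
    and int: "\<And>z. z \<in> F \<Longrightarrow> integrable M (g z)"
    and meas: "(\<lambda>\<omega>. g (Z \<omega>) \<omega>) \<in> borel_measurable M"
  shows "expectation (\<lambda>\<omega>. g (Z \<omega>) \<omega>) = (\<Sum>z\<in>F. pmf D z * expectation (g z))"
proof -
  let ?I = "\<lambda>z \<omega>. indicator {z} (Z \<omega>) :: real"
  have Im: "?I z \<in> borel_measurable M" for z
    using measurable_compose[OF Zm, of "indicator {z}" borel] by simp
  have EI: "expectation (?I z) = pmf D z" for z
  proof -
    have "expectation (?I z) = (\<integral>x. indicator {z} x \<partial>distr M (count_space UNIV) Z)"
      using Zm by (subst integral_distr) auto
    also have "\<dots> = pmf D z" by (simp add: Z measure_pmf_single)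
    finally show ?thesis .
  qed
  have Iint: "integrable M (?I z)" for z
  proof (rule integrable_const_bound[OF _ Im])
    show "AE \<omega> in M. norm (?I z \<omega>) \<le> 1" by (simp add: indicator_def)
  qed
  have "AE x in distr M (count_space UNIV) Z. x \<in> F"
    unfolding Z using F(2) by (auto simp: AE_measure_pmf_iff)
  then have "AE \<omega> in M. Z \<omega> \<in> F" using AE_distrD[OF Zm] by blast
  then have "AE \<omega> in M. g (Z \<omega>) \<omega> = (\<Sum>z\<in>F. g z \<omega> * ?I z \<omega>)"
  proof eventually_elim
    case (elim \<omega>)
    have "(\<Sum>z\<in>F. g z \<omega> * ?I z \<omega>) = (\<Sum>z\<in>F. if z = Z \<omega> then g z \<omega> else 0)"
      by (intro sum.cong) (auto simp: indicator_def)
    with elim F(1) show ?case by simp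
  qed
  then have "expectation (\<lambda>\<omega>. g (Z \<omega>) \<omega>) = expectation (\<lambda>\<omega>. \<Sum>z\<in>F. g z \<omega> * ?I z \<omega>)"
    using int by (intro integral_cong_AE meas borel_measurable_sum borel_measurable_times Im
        borel_measurable_integrable)
  also have "\<dots> = (\<Sum>z\<in>F. expectation (\<lambda>\<omega>. g z \<omega> * ?I z \<omega>))"
    by (intro Bochner_Integration.integral_sum indep_var_integrable ind int Iint)
  also have "\<dots> = (\<Sum>z\<in>F. expectation (g z) * pmf D z)"
    by (intro sum.cong refl) (simp add: indep_var_lebesgue_integral ind int Iint EI)
  finally show ?thesis by (simp add: mult.commute)
qed

text \<open>For \<open>\<rho> \<ge> 0\<close> the inequality can be iterated. For
  \<open>\<rho> < 0\<close> a positive \<open>u k\<close> would make \<open>u (Suc k)\<close>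
  negative, so the sequence vanishes.\<close>

lemma geometric_decay_of_nonneg:
  fixes u :: "nat \<Rightarrow> real"
  assumes "\<And>k. 0 \<le> u k" "\<And>k. u (Suc k) \<le> \<rho> * u k"
  shows "u k \<le> \<rho> ^ k * u 0"
proof (cases "\<rho> \<ge> 0")
  case True
  show ?thesis
  proof (induction k)
    case (Suc k)
    have "u (Suc k) \<le> \<rho> * u k" by (rule assms)
    also have "\<dots> \<le> \<rho> * (\<rho> ^ k * u 0)" using Suc True by (rule mult_left_mono)
    finally show ?case by simp
  qed simp
next
  case False
  have "u k = 0" for k
  proof (rule ccontr)
    assume "u k \<noteq> 0"
    then have "0 < u k" using assms(1)[of k] by simp
    with False have "\<rho> * u k < 0" by (simp add: mult_neg_pos)
    with assms(1)[of "Suc k"] assms(2)[of k] show False by simp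
  qed
  then show ?thesis by simp
qed

theorem theorem5p2:
  fixes m n r :: nat
    and A B :: "real mat"
    and b xstar x0 :: "real vec"
    and q :: "nat \<Rightarrow> nat"
    and Si :: "nat \<Rightarrow> real mat"
    and p :: "nat \<Rightarrow> real"
    and D :: "real mat pmf"
    and M :: "'w measure"
    and S :: "nat \<Rightarrow> 'w \<Rightarrow> real mat"
    and k :: nat
  assumes "A \<in> carrier_mat m n"
    and "b \<in> carrier_vec m"
    and "xstar \<in> carrier_vec n"
    and "A *\<^sub>v xstar = b"
    and "spd_mat n B"
    and "x0 \<in> carrier_vec n"
    and "complete_discrete_sampling m A r q Si p D"
    and "\<And>i. i \<in> {1..r} \<Longrightarrow>
           p i = trace_mat (transpose_mat (Si i) * A * inv_mat B * transpose_mat A * Si i)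
                 / (frob_norm (inv_sqrt_mat B * transpose_mat A * concat_mats m r Si))\<^sup>2"
    and "prob_space M"
    and "prob_space.indep_vars M (\<lambda>_. count_space UNIV) S UNIV"
    and "\<And>j. distr M (count_space UNIV) (S j) = measure_pmf D"
  shows "integrable M (\<lambda>\<omega>. (norm_wrt B (iterate A B b x0 (\<lambda>j. S j \<omega>) k - xstar))\<^sup>2)
    \<and> prob_space.expectation M
        (\<lambda>\<omega>. (norm_wrt B (iterate A B b x0 (\<lambda>j. S j \<omega>) k - xstar))\<^sup>2)
      \<le> (1 - lambda_min (transpose_mat (concat_mats m r Si) * A * inv_mat B
                           * transpose_mat A * concat_mats m r Si)
               / (frob_norm (inv_sqrt_mat B * transpose_mat A * concat_mats m r Si))\<^sup>2) ^ k
        * (norm_wrt B (x0 - xstar))\<^sup>2"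
proof -
  note A = assms(1) and b = assms(2) and xs = assms(3) and Axs = assms(4) and B = assms(5)
    and x0 = assms(6) and D = assms(7) and p = assms(8) and ind = assms(10) and distr = assms(11)
  interpret prob_space M by (rule assms(9))
  let ?F = "(frob_norm (inv_sqrt_mat B * transpose_mat A * concat_mats m r Si))\<^sup>2"
  define \<rho> where "\<rho> = 1 - lambda_min (transpose_mat (concat_mats m r Si) * A * inv_mat B
      * transpose_mat A * concat_mats m r Si) / ?F"
  let ?P = "Si ` {1..r}"
  let ?H = "\<lambda>K. \<Pi>\<^sub>M j\<in>{..<K}. count_space (UNIV :: real mat set)"
  \<comment> \<open>The error is a function of a deterministic sequence \<open>s\<close>, so that it
    can be evaluated at the random sequence, at its truncated history and at a history with one draw
    replaced.\<close>
  define err where "err s k = iterate A B b x0 s k - xstar" for s k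
  define u where "u s k = (norm_wrt B (err s k))\<^sup>2" for s k
  have Bi: "inv_mat B \<in> carrier_mat n n" using spd_inv_mat[OF B] by (simp add: spd_mat_def)
  have Bc: "B \<in> carrier_mat n n" using B by (simp add: spd_mat_def)
  note it_c = iterate_carrier[OF x0 Bi, where A = A and b = b]
  have err_c: "err s k \<in> carrier_vec n" for s k
    unfolding err_def using it_c xs by (intro minus_carrier_vec)
  have err_Suc: "err s (Suc k) = err s k - correction_mat A B (s k) *\<^sub>v (A *\<^sub>v err s k)" for s k
    unfolding err_def by (rule iterate_Suc_error[OF A xs Axs it_c Bi])
  have u_cong: "u s k = u t k" if "\<And>j. j < k \<Longrightarrow> s j = t j" for s t k
    using iterate_cong[of k s t A B b x0] that by (simp add: u_def err_def)
  have u_nonneg: "0 \<le> u s k" for s k by (simp add: u_def)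
  have u_decr: "u s (Suc k) \<le> u s k" if X: "s k \<in> ?P" for s k
  proof -
    have "s k \<in> carrier_mat m (dim_col (s k)) \<and> full_row_rank (transpose_mat (s k) * A)"
      using X D by (auto simp: complete_discrete_sampling_def)
    then show ?thesis
      unfolding u_def err_Suc using correction_step(2)[OF A _ B _ err_c] by blast
  qed
  have u_bound: "u s k \<le> u s 0" if "\<And>j. j < k \<Longrightarrow> s j \<in> ?P" for s k
    using that
  proof (induction k)
    case (Suc k)
    then show ?case using u_decr[of s k] by fastforce
  qed simp
  have u0: "u s 0 = (norm_wrt B (x0 - xstar))\<^sup>2" for s by (simp add: u_def err_def)
  have u_meas: "(\<lambda>h. u h k) \<in> borel_measurable (?H k)" for k
    unfolding u_def
  proof (rule borel_measurable_norm_wrt_sq[OF _ err_c Bc])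
    fix l assume l: "l < n"
    have "err h k $ l = iterate A B b x0 h k $ l - xstar $ l" for h
      using l xs by (simp add: err_def)
    then show "(\<lambda>h. err h k $ l) \<in> borel_measurable (?H k)"
      using borel_measurable_iterate_index[OF x0 Bi A b order_refl l] by simp
  qed
  have S_meas: "S j \<in> measurable M (count_space UNIV)" for j
    using ind by (auto simp: indep_vars_def)
  have hist_meas: "(\<lambda>\<omega>. \<lambda>j\<in>{..<k}. S j \<omega>) \<in> measurable M (?H k)" for k
    by (intro measurable_restrict S_meas)
  have u_hist: "u (\<lambda>j\<in>{..<k}. S j \<omega>) k = u (\<lambda>j. S j \<omega>) k" for k \<omega>
    by (rule u_cong) simp
  have uS_meas: "(\<lambda>\<omega>. u (\<lambda>j. S j \<omega>) k) \<in> borel_measurable M" for k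
    using measurable_compose[OF hist_meas u_meas] by (simp add: u_hist)
  have supp: "AE \<omega> in M. \<forall>j. S j \<omega> \<in> ?P"
  proof -
    have "AE \<omega> in M. S j \<omega> \<in> ?P" for j
    proof (rule AE_distrD[OF S_meas])
      show "AE X in distr M (count_space UNIV) (S j). X \<in> ?P"
        unfolding distr using sampling_set_pmf[OF D] by (auto simp: AE_measure_pmf_iff)
    qed
    then show ?thesis by (simp add: AE_all_countable)
  qed
  \<comment> \<open>No step increases the error on the support, so the initial error is an almost
    sure bound.\<close>
  have u_int: "integrable M (\<lambda>\<omega>. u (\<lambda>j. S j \<omega>) k)" for k
  proof (rule integrable_const_bound[OF _ uS_meas])
    show "AE \<omega> in M. norm (u (\<lambda>j. S j \<omega>) k) \<le> (norm_wrt B (x0 - xstar))\<^sup>2"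
      using supp
    proof eventually_elim
      case (elim \<omega>)
      then show ?case using u_bound[of k "\<lambda>j. S j \<omega>"] u_nonneg by (simp add: u0)
    qed
  qed
  have "expectation (\<lambda>\<omega>. u (\<lambda>j. S j \<omega>) (Suc k)) \<le> \<rho> * expectation (\<lambda>\<omega>. u (\<lambda>j. S j \<omega>) k)" for k
  proof -
    \<comment> \<open>Draw number \<open>k\<close> produces iterate \<open>Suc k\<close>, so the
      past consists of the draws below \<open>k\<close>. \<open>f h X\<close> is the next squared
      error for history \<open>h\<close> and next draw \<open>X\<close>.\<close>
    define Y where "Y \<omega> = (\<lambda>j\<in>{..<k}. S j \<omega>)" for \<omega>
    define f where "f h X = u (h(k := X)) (Suc k)" for h X
    have f_eq: "f (Y \<omega>) (S k \<omega>) = u (\<lambda>j. S j \<omega>) (Suc k)" for \<omega>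
      unfolding f_def by (rule u_cong) (auto simp: Y_def)
    have f_corr: "f h X = (norm_wrt B (err h k - correction_mat A B X *\<^sub>v (A *\<^sub>v err h k)))\<^sup>2" for h X
    proof -
      have "err (h(k := X)) k = err h k"
        using iterate_cong[of k "h(k := X)" h A B b x0] by (simp add: err_def)
      then show ?thesis by (simp add: f_def u_def err_Suc)
    qed
    have f_meas: "(\<lambda>h. f h X) \<in> borel_measurable (?H k)" for X
    proof -
      have "(\<lambda>h. h(k := X)) \<in> measurable (?H k) (?H (Suc k))"
        by (rule measurable_fun_upd[of _ "{..<k}"]) auto
      then show ?thesis unfolding f_def by (rule measurable_compose[OF _ u_meas])
    qed
    \<comment> \<open>The index sets \<open>{..<k}\<close> and \<open>{k}\<close> are disjoint, so
      the history and the next draw are independent blocks, and so are measurable functions of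
      them.\<close>
    have indep: "indep_var borel (\<lambda>\<omega>. f (Y \<omega>) X) borel (\<lambda>\<omega>. indicator {X} (S k \<omega>))" for X
    proof -
      have "indep_var borel ((\<lambda>h. f h X) \<circ> Y) borel
          ((\<lambda>h. indicator {X} (h k)) \<circ> (\<lambda>\<omega>. \<lambda>j\<in>{k}. S j \<omega>))"
      proof (rule indep_var_compose[OF _ f_meas])
        show "indep_var (?H k) Y (\<Pi>\<^sub>M j\<in>{k}. count_space UNIV) (\<lambda>\<omega>. \<lambda>j\<in>{k}. S j \<omega>)"
          unfolding Y_def by (rule indep_var_restrict[OF ind]) auto
        have "(\<lambda>h. h k) \<in> measurable (\<Pi>\<^sub>M j\<in>{k}. count_space (UNIV :: real mat set)) (count_space UNIV)"
          by (rule measurable_component_singleton) simp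
        then show "(\<lambda>h. indicator {X} (h k)) \<in> borel_measurable (\<Pi>\<^sub>M j\<in>{k}. count_space UNIV)"
          by (rule measurable_compose) simp
      qed
      then show ?thesis by (simp add: comp_def)
    qed
    have f_int: "integrable M (\<lambda>\<omega>. f (Y \<omega>) X)" if X: "X \<in> ?P" for X
    proof (rule integrable_const_bound)
      show "(\<lambda>\<omega>. f (Y \<omega>) X) \<in> borel_measurable M"
        unfolding Y_def by (rule measurable_compose[OF hist_meas f_meas])
      show "AE \<omega> in M. norm (f (Y \<omega>) X) \<le> (norm_wrt B (x0 - xstar))\<^sup>2"
        using supp
      proof eventually_elim
        case (elim \<omega>)
        have "f (Y \<omega>) X \<le> u ((Y \<omega>)(k := X)) 0"
          unfolding f_def using elim X by (intro u_bound) (auto simp: Y_def)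
        then show ?case using u_nonneg by (simp add: u0 f_def)
      qed
    qed
    have "expectation (\<lambda>\<omega>. u (\<lambda>j. S j \<omega>) (Suc k)) = expectation (\<lambda>\<omega>. f (Y \<omega>) (S k \<omega>))"
      by (simp only: f_eq)
    also have "\<dots> = (\<Sum>X\<in>?P. pmf D X * expectation (\<lambda>\<omega>. f (Y \<omega>) X))"
    proof (rule expectation_indep_finite_pmf[OF indep S_meas distr _ sampling_set_pmf[OF D] f_int])
      show "(\<lambda>\<omega>. f (Y \<omega>) (S k \<omega>)) \<in> borel_measurable M" unfolding f_eq by (rule uS_meas)
    qed auto
    also have "\<dots> = expectation (\<lambda>\<omega>. \<Sum>X\<in>?P. pmf D X * f (Y \<omega>) X)"
      using f_int by (subst Bochner_Integration.integral_sum) auto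
    also have "\<dots> \<le> expectation (\<lambda>\<omega>. \<rho> * u (\<lambda>j. S j \<omega>) k)"
    proof (rule integral_mono)
      show "integrable M (\<lambda>\<omega>. \<Sum>X\<in>?P. pmf D X * f (Y \<omega>) X)"
        using f_int by (intro Bochner_Integration.integrable_sum integrable_mult_right)
      show "integrable M (\<lambda>\<omega>. \<rho> * u (\<lambda>j. S j \<omega>) k)" by (intro integrable_mult_right u_int)
      \<comment> \<open>The one-step bound holds for every error vector, hence at every
        \<open>\<omega>\<close>, including those where past draws left the support.\<close>
      show "(\<Sum>X\<in>?P. pmf D X * f (Y \<omega>) X) \<le> \<rho> * u (\<lambda>j. S j \<omega>) k" for \<omega>
      proof -
        have "(\<Sum>X\<in>?P. pmf D X * f (Y \<omega>) X) \<le> \<rho> * (norm_wrt B (err (Y \<omega>) k))\<^sup>2"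
          unfolding f_corr \<rho>_def
          by (rule expected_correction_step[OF A B D err_c p]) auto
        also have "(norm_wrt B (err (Y \<omega>) k))\<^sup>2 = u (\<lambda>j. S j \<omega>) k"
          using u_hist[of \<omega> k] by (simp add: Y_def u_def)
        finally show ?thesis .
      qed
    qed
    finally show ?thesis by simp
  qed
  then have "expectation (\<lambda>\<omega>. u (\<lambda>j. S j \<omega>) k)
      \<le> \<rho> ^ k * expectation (\<lambda>\<omega>. u (\<lambda>j. S j \<omega>) 0)"
    by (intro geometric_decay_of_nonneg integral_nonneg_AE AE_I2 u_nonneg)
  also have "expectation (\<lambda>\<omega>. u (\<lambda>j. S j \<omega>) 0) = (norm_wrt B (x0 - xstar))\<^sup>2"
    by (simp add: u0 prob_space)
  finally show ?thesis using u_int[of k] unfolding u_def err_def \<rho>_def by blast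
qed

end
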